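(* Let $X$ be a real Banach space with $\dim X\ge2$. If $\mathfrak{s}_2(X)<\infty$, then $$J^B_{X,2}(\tau)^2\le1+\mathfrak{s}_2(X)\tau^2\qquad(0\le\tau\le1),$$ and $$C^B_2(X)\le\begin{cases}1,&\mathfrak{s}_2(X)\le1,\\[0.3em]\dfrac{1+\mathfrak{s}_2(X)}{2},&\mathfrak{s}_2(X)\ge1.\end{cases}$$ Consequently, for $-\infty\le t\le2$, the same upper bound holds for $C^B_t(X)$.
   Context: $S_X$ denotes the unit sphere of $X$. For $x,y\in X$, Birkhoff-James orthogonality $x\perp_B y$ means $\|x+\lambda y\|\ge\|x\|$ for all $\lambda\in\mathbb{R}$. For $a,b>0$ set $M_t(a,b)=\left(\frac{a^t+b^t}{2}\right)^{1/t}$ if $t\in\mathbb{R}\setminus\{0\}$, $M_0(a,b)=\sqrt{ab}$, and $M_{-\infty}(a,b)=\min\{a,b\}$. For $-\infty\le t<\infty$ and $\tau\ge 0$ define $$J^B_{X,t}(\tau)=\sup\{M_t(\|x+\tau y\|,\|x-\tau y\|): x,y\in S_X,\ x\perp_B y\},\qquad C^B_t(X)=\sup_{0\le\tau\le1}\frac{J^B_{X,t}(\tau)^2}{1+\tau^2}.$$ The quadratic smoothness coefficient is $$\mathfrak{s}_2(X)=\sup_{u\in S_X,\ v\in X\setminus\{0\}}\frac{\|u+v\|^2+\|u-v\|^2-2}{2\|v\|^2}\in(-\infty,+\infty].$$ *)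

theory Defs
  imports "HOL-Analysis.Analysis"
begin

definition birkhoff_james :: "'a::real_normed_vector \<Rightarrow> 'a \<Rightarrow> bool"  (infix "\<bottom>\<^sub>B" 50)
  where "x \<bottom>\<^sub>B y \<longleftrightarrow> (\<forall>l::real. norm (x + l *\<^sub>R y) \<ge> norm x)"

text \<open>
  The mean is meant for positive \<open>a\<close>, \<open>b\<close> and exponents \<open>t < \<infinity>\<close>; the value at
  \<open>t = \<infinity>\<close> only makes the function total.
\<close>

definition power_mean :: "ereal \<Rightarrow> real \<Rightarrow> real \<Rightarrow> real"
  where "power_mean t a b =
    (case t of
       ereal r \<Rightarrow> if r = 0 then sqrt (a * b) else ((a powr r + b powr r) / 2) powr (1 / r)
     | PInfty \<Rightarrow> max a b
     | MInfty \<Rightarrow> min a b)"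

text \<open>
  The space \<open>X\<close> is the type \<open>'a\<close>, passed as a type argument.
  The suprema defining \<open>J_B\<close> and \<open>C_B\<close> are taken in the reals: if \<open>x \<bottom>\<^sub>B y\<close> are unit
  vectors and \<open>\<tau> \<ge> 0\<close>, both norms lie between \<open>1\<close> and \<open>1 + \<tau>\<close>, hence so does their mean,
  and in dimension at least \<open>2\<close> such pairs exist.  The supremum defining \<open>s2\<close> may be
  infinite and is taken in the extended reals.
\<close>

definition J_B :: "'a::real_normed_vector itself \<Rightarrow> ereal \<Rightarrow> real \<Rightarrow> real"
  where "J_B X t \<tau> =
    Sup {power_mean t (norm (x + \<tau> *\<^sub>R y)) (norm (x - \<tau> *\<^sub>R y)) | x y :: 'a.
           x \<in> sphere 0 1 \<and> y \<in> sphere 0 1 \<and> x \<bottom>\<^sub>B y}"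

definition C_B :: "'a::real_normed_vector itself \<Rightarrow> ereal \<Rightarrow> real"
  where "C_B X t = (SUP \<tau>\<in>{0..1}. (J_B X t \<tau>)\<^sup>2 / (1 + \<tau>\<^sup>2))"

definition s2 :: "'a::real_normed_vector itself \<Rightarrow> ereal"
  where "s2 X =
    (SUP (u, v) \<in> sphere (0::'a) 1 \<times> (UNIV - {0}).
       ereal (((norm (u + v))\<^sup>2 + (norm (u - v))\<^sup>2 - 2) / (2 * (norm v)\<^sup>2)))"

end

theory Submission
  imports Defs
begin

text \<open>For unit vectors \<open>x\<close>, \<open>y\<close>, taking u = x and v = \<tau> y in
  the supremum defining \<open>s2\<close> bounds the mean of the two squared norms by 1 + s
  \<tau>^2, where s is the value of \<open>s2\<close> (\<open>s2_bound\<close>). Power means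
  increase with the exponent, so for t \<le> 2 the mean is at most the quadratic one
  (\<open>power_mean_le_quadratic_mean\<close>), and the supremum over orthogonal pairs gives
  \<open>J_B_bound\<close>. The quotient (1 + s q) / (1 + q) is monotone in q = \<tau>^2 on [0,1],
  so it is at most the larger of its end values 1 and (1 + s) / 2, which gives
  \<open>C_B_bound\<close>. The suprema are real-valued, so they must be shown to range over
  nonempty, bounded sets; \<open>exists_birkhoff_james_unit_vectors\<close> supplies a pair in
  dimension at least 2.\<close>

lemma power_mean_nonneg:
  assumes "a \<ge> 0" "b \<ge> 0"
  shows "power_mean t a b \<ge> 0"
  using assms by (cases t) (auto simp: power_mean_def)

lemma convex_powr_mean:
  fixes a b p :: real
  assumes "a > 0" "b > 0" "p \<ge> 1"
  shows "((a + b) / 2) powr p \<le> (a powr p + b powr p) / 2"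
  using convex_onD[OF powr_convex[OF assms(3)], of "1/2" a b] assms
  by (simp add: add_divide_distrib)

lemma sqrt_le_quadratic_mean:
  fixes a b :: real
  shows "sqrt (a * b) \<le> sqrt ((a\<^sup>2 + b\<^sup>2) / 2)"
  using sum_squares_bound[of a b] by simp

text \<open>Exponents up to 0 are compared through the minimum or the geometric mean; positive ones
  follow from convexity of the power 2/r.\<close>

lemma power_mean_le_quadratic_mean:
  fixes a b :: real
  assumes ab: "a > 0" "b > 0" and t: "t \<le> 2"
  shows "power_mean t a b \<le> sqrt ((a\<^sup>2 + b\<^sup>2) / 2)"
proof (cases t)
  case PInf
  with t show ?thesis by simp
next
  case MInf
  have "(min a b)\<^sup>2 \<le> (a\<^sup>2 + b\<^sup>2) / 2"
    using ab power_mono[of a b 2] power_mono[of b a 2] by (cases "a \<le> b") simp_all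
  then show ?thesis
    using MInf by (simp add: power_mean_def real_le_rsqrt)
next
  case (real r)
  with t have r: "r \<le> 2" by simp
  consider "r = 0" | "r < 0" | "r > 0" by linarith
  then show ?thesis
  proof cases
    case 1
    with real show ?thesis
      using sqrt_le_quadratic_mean by (simp add: power_mean_def)
  next
    case 2
    have "sqrt (a powr r * b powr r) \<le> (a powr r + b powr r) / 2"
      by (rule arith_geo_mean_sqrt) auto
    \<comment> \<open>Since 1/r is negative, raising to this power reverses the AM-GM
      inequality.\<close>
    then have "((a powr r + b powr r) / 2) powr (1 / r) \<le> sqrt (a powr r * b powr r) powr (1 / r)"
      using 2 ab by (intro powr_mono2') auto
    also have "\<dots> = sqrt (a * b)"
      using 2 ab by (simp add: powr_half_sqrt[symmetric] powr_powr powr_mult)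
    also note sqrt_le_quadratic_mean
    finally show ?thesis using 2 real by (simp add: power_mean_def)
  next
    case 3
    let ?m = "(a powr r + b powr r) / 2"
    \<comment> \<open>Here 0 < r \<le> 2 makes 2/r at least 1, as convexity requires.\<close>
    have "?m powr (2 / r) \<le> ((a powr r) powr (2 / r) + (b powr r) powr (2 / r)) / 2"
      using 3 r ab by (intro convex_powr_mean) auto
    also have "\<dots> = (a\<^sup>2 + b\<^sup>2) / 2"
      using 3 ab by (simp add: powr_powr)
    finally have "(?m powr (1 / r))\<^sup>2 \<le> (a\<^sup>2 + b\<^sup>2) / 2"
      using ab by (simp add: powr_powr flip: powr_numeral)
    then show ?thesis using 3 real by (simp add: power_mean_def real_le_rsqrt)
  qed
qed

lemma exists_min_norm_on_line:
  fixes a b :: "'a::real_normed_vector"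
  assumes "b \<noteq> 0"
  shows "\<exists>m::real. \<forall>l. norm (a + m *\<^sub>R b) \<le> norm (a + l *\<^sub>R b)"
proof -
  \<comment> \<open>Beyond this radius the reverse triangle inequality already gives a norm of at
    least \<open>norm a\<close>, the value at l = 0, so a minimum over the compact interval is
    global.\<close>
  define R where "R = 2 * norm a / norm b"
  have R: "R \<ge> 0" "R * norm b = 2 * norm a"
    using assms by (auto simp: R_def)
  have "continuous_on {-R..R} (\<lambda>l. norm (a + l *\<^sub>R b))"
    by (intro continuous_intros)
  moreover have "{-R..R} \<noteq> {}"
    using R by simp
  ultimately obtain m where m: "\<And>l. l \<in> {-R..R} \<Longrightarrow> norm (a + m *\<^sub>R b) \<le> norm (a + l *\<^sub>R b)"
    using continuous_attains_inf[OF compact_Icc] by blast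
  have "norm (a + m *\<^sub>R b) \<le> norm (a + l *\<^sub>R b)" if "l \<notin> {-R..R}" for l
  proof -
    have "R * norm b \<le> \<bar>l\<bar> * norm b"
      using that by (intro mult_right_mono) auto
    moreover have "\<bar>l\<bar> * norm b - norm a \<le> norm (a + l *\<^sub>R b)"
      using norm_diff_ineq[of "l *\<^sub>R b" a] by (simp add: add.commute)
    ultimately show ?thesis
      using m[of 0] R by simp
  qed
  with m show ?thesis by blast
qed

lemma birkhoff_james_scaleR:
  fixes x y :: "'a::real_normed_vector"
  assumes "x \<bottom>\<^sub>B y" "c \<noteq> 0"
  shows "c *\<^sub>R x \<bottom>\<^sub>B d *\<^sub>R y"
  unfolding birkhoff_james_def
proof
  fix l
  have "norm (c *\<^sub>R x) \<le> \<bar>c\<bar> * norm (x + (l * d / c) *\<^sub>R y)"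
    using assms(1) by (simp add: birkhoff_james_def mult_left_mono)
  also have "\<dots> = norm (c *\<^sub>R (x + (l * d / c) *\<^sub>R y))"
    by simp
  also have "\<dots> = norm (c *\<^sub>R x + l *\<^sub>R d *\<^sub>R y)"
    using assms(2) by (simp add: scaleR_add_right)
  finally show "norm (c *\<^sub>R x) \<le> norm (c *\<^sub>R x + l *\<^sub>R d *\<^sub>R y)" .
qed

text \<open>Moving \<open>a\<close> along the direction \<open>b\<close> to a point of least norm
  makes it orthogonal to \<open>b\<close>; independence keeps that point nonzero, and orthogonality
  survives normalization.\<close>

lemma exists_birkhoff_james_unit_vectors:
  assumes "\<exists>B::'a::real_normed_vector set. independent B \<and> card B = 2"
  obtains x y :: "'a::real_normed_vector" where "norm x = 1" "norm y = 1" "x \<bottom>\<^sub>B y"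
proof -
  obtain B :: "'a set" where B: "independent B" "card B = 2"
    using assms by blast
  from B(2) obtain a b where "B = {a, b}" and "a \<noteq> b"
    unfolding card_2_iff by blast
  with B(1) have ab: "a \<noteq> b" "independent {a, b}"
    by simp_all
  have b: "b \<noteq> 0"
    using ab dependent_zero by blast
  then obtain m where m: "\<And>l. norm (a + m *\<^sub>R b) \<le> norm (a + l *\<^sub>R b)"
    using exists_min_norm_on_line by blast
  define x where "x = a + m *\<^sub>R b"
  have "x \<noteq> 0"
  proof
    assume "x = 0"
    then have "a = (- m) *\<^sub>R b"
      by (simp add: x_def add_eq_0_iff2)
    then have "a \<in> span {b}"
      by (metis span_base span_scale singletonI)
    with ab show False
      by (simp add: independent_insert)
  qed
  moreover have "x \<bottom>\<^sub>B b"
    using m by (auto simp: x_def birkhoff_james_def add.assoc simp flip: scaleR_left_distrib)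
  ultimately have "x /\<^sub>R norm x \<bottom>\<^sub>B b /\<^sub>R norm b"
    by (intro birkhoff_james_scaleR) auto
  then show thesis
    using \<open>x \<noteq> 0\<close> b that[of "x /\<^sub>R norm x" "b /\<^sub>R norm b"] by simp
qed

text \<open>For unit \<open>x\<close> this keeps both norms positive, as the comparison of power
  means requires.\<close>

lemma birkhoff_james_norm_ge:
  assumes "x \<bottom>\<^sub>B y"
  shows "norm x \<le> norm (x + \<tau> *\<^sub>R y)" "norm x \<le> norm (x - \<tau> *\<^sub>R y)"
  using assms[unfolded birkhoff_james_def, rule_format, of \<tau>]
    assms[unfolded birkhoff_james_def, rule_format, of "-\<tau>"] by auto

lemma s2_bound:
  fixes X :: "'a::real_normed_vector itself" and u v :: 'a
  assumes s: "s2 X = ereal s" and u: "norm u = 1"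
  shows "((norm (u + v))\<^sup>2 + (norm (u - v))\<^sup>2) / 2 \<le> 1 + s * (norm v)\<^sup>2"
proof (cases "v = 0")
  case True
  with u show ?thesis by simp
next
  case False
  have "ereal (((norm (u + v))\<^sup>2 + (norm (u - v))\<^sup>2 - 2) / (2 * (norm v)\<^sup>2)) \<le> s2 X"
    unfolding s2_def using False u by (intro SUP_upper2[of "(u, v)"]) auto
  with s False show ?thesis by (simp add: field_simps)
qed

lemma J_B_bound:
  fixes X :: "'a::real_normed_vector itself"
  assumes dim: "\<exists>B::'a set. independent B \<and> card B = 2"
    and s: "s2 X = ereal s" and t: "t \<le> 2"
  shows "(J_B X t \<tau>)\<^sup>2 \<le> 1 + s * \<tau>\<^sup>2"
proof -
  let ?S = "{power_mean t (norm (x + \<tau> *\<^sub>R y)) (norm (x - \<tau> *\<^sub>R y)) | x y :: 'a.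
           x \<in> sphere 0 1 \<and> y \<in> sphere 0 1 \<and> x \<bottom>\<^sub>B y}"
  have le: "q \<le> sqrt (1 + s * \<tau>\<^sup>2)" and q0: "0 \<le> q" if q_in: "q \<in> ?S" for q
  proof -
    obtain x y :: 'a where q: "q = power_mean t (norm (x + \<tau> *\<^sub>R y)) (norm (x - \<tau> *\<^sub>R y))"
      and xy: "norm x = 1" "norm y = 1" "x \<bottom>\<^sub>B y"
      using q_in unfolding mem_Collect_eq mem_sphere_0 by blast
    have "norm (x + \<tau> *\<^sub>R y) > 0" "norm (x - \<tau> *\<^sub>R y) > 0"
      using birkhoff_james_norm_ge[OF xy(3), of \<tau>] xy(1) by linarith+
    then have "q \<le> sqrt (((norm (x + \<tau> *\<^sub>R y))\<^sup>2 + (norm (x - \<tau> *\<^sub>R y))\<^sup>2) / 2)"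
      unfolding q using t by (rule power_mean_le_quadratic_mean)
    also have "\<dots> \<le> sqrt (1 + s * \<tau>\<^sup>2)"
      using s2_bound[OF s xy(1), of "\<tau> *\<^sub>R y"] xy(2)
      by (intro real_sqrt_le_mono) (simp add: power_mult_distrib)
    finally show "q \<le> sqrt (1 + s * \<tau>\<^sup>2)" .
    show "0 \<le> q"
      unfolding q by (rule power_mean_nonneg) auto
  qed
  obtain x y :: 'a where xy: "norm x = 1" "norm y = 1" "x \<bottom>\<^sub>B y"
    using exists_birkhoff_james_unit_vectors[OF dim] .
  then have mem: "power_mean t (norm (x + \<tau> *\<^sub>R y)) (norm (x - \<tau> *\<^sub>R y)) \<in> ?S"
    by auto
  have J: "J_B X t \<tau> \<le> sqrt (1 + s * \<tau>\<^sup>2)"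
    unfolding J_B_def using mem le by (intro cSup_least) blast+
  have "bdd_above ?S"
    using le by (rule bdd_aboveI)
  \<comment> \<open>An upper bound can be squared only once the supremum is known to be nonnegative.
    As \<open>sqrt\<close> is odd on the reals, the two bounds together also force the radicand to
    be nonnegative.\<close>
  then have "0 \<le> J_B X t \<tau>"
    unfolding J_B_def using mem q0 by (intro cSup_upper2[OF mem]) blast+
  with J show ?thesis
    using sqrt_ge_absD by fastforce
qed

lemma C_B_bound:
  fixes X :: "'a::real_normed_vector itself"
  assumes "\<exists>B::'a set. independent B \<and> card B = 2"
    and "s2 X = ereal s" and "t \<le> 2"
  shows "C_B X t \<le> max 1 ((1 + s) / 2)"
  unfolding C_B_def
proof (rule cSUP_least)
  fix \<tau> :: real
  assume "\<tau> \<in> {0..1}"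
  then have \<tau>: "\<tau>\<^sup>2 \<le> 1"
    by (simp add: power_le_one)
  have "1 + s * \<tau>\<^sup>2 \<le> max 1 ((1 + s) / 2) * (1 + \<tau>\<^sup>2)"
  proof (cases "s \<le> 1")
    case True
    then show ?thesis
      using mult_right_mono[of s 1 "\<tau>\<^sup>2"] by simp
  next
    case False
    \<comment> \<open>This product is twice the difference between (1 + s) / 2 * (1 + \<tau>^2) and
      1 + s \<tau>^2.\<close>
    then have "0 \<le> (s - 1) * (1 - \<tau>\<^sup>2)"
      using \<tau> by simp
    with False show ?thesis
      by (simp add: max_def field_simps)
  qed
  then have "(J_B X t \<tau>)\<^sup>2 \<le> max 1 ((1 + s) / 2) * (1 + \<tau>\<^sup>2)"
    using J_B_bound[OF assms] order_trans by blast
  then show "(J_B X t \<tau>)\<^sup>2 / (1 + \<tau>\<^sup>2) \<le> max 1 ((1 + s) / 2)"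
    by (simp add: pos_divide_le_eq add_pos_nonneg)
qed simp

theorem proposition13:
  fixes X :: "'a::banach itself"
  assumes dim_ge_2: "\<exists>B::'a set. independent B \<and> card B = 2"
    and s2_finite: "s2 X < \<infinity>"
  shows "(\<forall>\<tau>::real. 0 \<le> \<tau> \<and> \<tau> \<le> 1 \<longrightarrow>
            ereal ((J_B X 2 \<tau>)\<^sup>2) \<le> 1 + s2 X * ereal (\<tau>\<^sup>2))
       \<and> ((s2 X \<le> 1 \<longrightarrow> ereal (C_B X 2) \<le> 1)
          \<and> (s2 X \<ge> 1 \<longrightarrow> ereal (C_B X 2) \<le> (1 + s2 X) / 2))
       \<and> (\<forall>t::ereal. -\<infinity> \<le> t \<and> t \<le> 2 \<longrightarrow>
            (s2 X \<le> 1 \<longrightarrow> ereal (C_B X t) \<le> 1)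
            \<and> (s2 X \<ge> 1 \<longrightarrow> ereal (C_B X t) \<le> (1 + s2 X) / 2))"
proof -
  obtain x y :: 'a where xy: "norm x = 1" "norm y = 1"
    using exists_birkhoff_james_unit_vectors[OF dim_ge_2] .
  \<comment> \<open>One admissible pair rules out the value -\<infinity>, so \<open>s2 X\<close> is
    a real number.\<close>
  have "ereal (((norm (x + y))\<^sup>2 + (norm (x - y))\<^sup>2 - 2) / (2 * (norm y)\<^sup>2)) \<le> s2 X"
    unfolding s2_def using xy by (intro SUP_upper2[of "(x, y)"]) auto
  with s2_finite obtain s where s: "s2 X = ereal s"
    by (cases "s2 X") auto
  have J: "ereal ((J_B X 2 \<tau>)\<^sup>2) \<le> 1 + s2 X * ereal (\<tau>\<^sup>2)" for \<tau>
    using J_B_bound[OF dim_ge_2 s order_refl, of \<tau>] by (simp add: s one_ereal_def)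
  have C: "(s2 X \<le> 1 \<longrightarrow> ereal (C_B X t) \<le> 1)
      \<and> (s2 X \<ge> 1 \<longrightarrow> ereal (C_B X t) \<le> (1 + s2 X) / 2)" if "t \<le> 2" for t
  proof -
    have half: "(1 + s2 X) / 2 = ereal ((1 + s) / 2)"
      unfolding s using ereal_divide[of "1 + s" 2] by (simp add: one_ereal_def)
    show ?thesis
      using C_B_bound[OF dim_ge_2 s that] unfolding half
      by (auto simp: s one_ereal_def max_def split: if_splits)
  qed
  show ?thesis
    using J C by blast
qed

end
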